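(* Suppose $\ell_\theta$ is $\gamma_\theta$-strongly convex in $\theta$ and $L_\theta$-smooth in $(x,y)$ and $\theta$; $\ell_\phi$ is $\gamma_\phi$-strongly convex in $\phi$ and $L_\phi$-smooth in $(x,y)$ and $\phi$; and the distribution maps $P(\theta,\phi)$ and $Q(\theta,\phi)$ are $\varepsilon_\theta$-sensitive and $\varepsilon_\phi$-sensitive respectively. Define $$\kappa=\max\left(\frac{\gamma_\theta L_\phi\varepsilon_\phi+2\gamma_\phi L_\theta\varepsilon_\theta}{\gamma_\phi(\gamma_\theta-L_\theta\varepsilon_\theta)},\ \frac{\gamma_\phi L_\theta\varepsilon_\theta+2\gamma_\theta L_\phi\varepsilon_\phi}{\gamma_\theta(\gamma_\phi-L_\phi\varepsilon_\phi)},\ \frac{L_\theta\varepsilon_\theta}{\gamma_\theta}+\frac{L_\phi\varepsilon_\phi}{\gamma_\phi}\right).$$ If $\kappa<1$, then a stable point $(\theta^*,\phi^* )$ exists, and the iterative training loop (with any choice of synchronous or asynchronous update order in each round) drives $(\theta_t,\phi_t)$ to converge to $(\theta^*,\phi^* )$ at a linear rate: for all $t\ge 0$, $$\|(\theta_t,\phi_t)-(\theta^*,\phi^* )\|\le\kappa^t\,\|(\theta_0,\phi_0)-(\theta^*,\phi^* )\|.$$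
   Context: $\Theta,\Phi$ are closed convex subsets of Euclidean spaces; $\mathcal X,\mathcal Y$ are data spaces (subsets of Euclidean spaces); $\ell_\theta(x,y)$, $\ell_\phi(x,y)$ are loss functions with parameters $\theta\in\Theta$, $\phi\in\Phi$. For each $(\theta,\phi)\in\Theta\times\Phi$, $P(\theta,\phi)$ and $Q(\theta,\phi)$ are probability distributions on $\mathcal X\times\mathcal Y$ (the training data distributions of the two models, which depend on both models because synthetic data generated by them is reused). Iterative training loop: in each round $t$, $\theta_{t+1}=\arg\min_\theta\mathbb E_{(x,y)\sim P_{t+1}}[\ell_\theta(x,y)]$ and $\phi_{t+1}=\arg\min_\phi\mathbb E_{(x,y)\sim Q_{t+1}}[\ell_\phi(x,y)]$, where each round follows one of three update orders: synchronous, $P_{t+1}=P(\theta_t,\phi_t)$, $Q_{t+1}=Q(\theta_t,\phi_t)$; asynchronous with $\theta$ first, $P_{t+1}=P(\theta_t,\phi_t)$, $Q_{t+1}=Q(\theta_{t+1},\phi_t)$; asynchronous with $\phi$ first, $Q_{t+1}=Q(\theta_t,\phi_t)$, $P_{t+1}=P(\theta_t,\phi_{t+1})$. Stable point: $(\theta^*,\phi^* )$ with $\theta^*=\arg\min_\theta\mathbb E_{(x,y)\sim P(\theta^*,\phi^* )}[\ell_\theta(x,y)]$ and $\phi^*=\arg\min_\phi\mathbb E_{(x,y)\sim Q(\theta^*,\phi^* )}[\ell_\phi(x,y)]$. Strong convexity: $\ell_\theta(\theta)\ge\ell_\theta(\theta')+\nabla_\theta\ell_\theta(\theta')^T(\theta-\theta')+\frac{\gamma_\theta}{2}\|\theta-\theta'\|^2$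 for all $\theta,\theta'$ (and every data point), with $\gamma_\theta>0$; similarly for $\phi$. Smoothness: $\|\nabla_\theta\ell_\theta(x,y)-\nabla_\theta\ell_\theta(x',y')\|\le L_\theta\|(x,y)-(x',y')\|$ and $\|\nabla_\theta\ell_\theta(\theta)-\nabla_\theta\ell_\theta(\theta')\|\le L_\theta\|\theta-\theta'\|$ for all $(x,y),(x',y'),\theta,\theta'$; similarly for $\phi$ with $L_\phi$. Sensitivity: $W(P(\theta,\phi),P(\theta',\phi'))\le\varepsilon_\theta\|(\theta,\phi)-(\theta',\phi')\|$ for all $(\theta,\phi),(\theta',\phi')$, where $W$ is the Wasserstein-1 distance; similarly $W(Q(\theta,\phi),Q(\theta',\phi'))\le\varepsilon_\phi\|(\theta,\phi)-(\theta',\phi')\|$. *)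

theory Defs
  imports "HOL-Probability.Probability"
begin

definition distribution_on :: "'z::topological_space set \<Rightarrow> 'z measure \<Rightarrow> bool" where
  "distribution_on Z M \<longleftrightarrow> prob_space M \<and> sets M = sets (restrict_space borel Z)"

definition couplings :: "'z measure \<Rightarrow> 'z measure \<Rightarrow> ('z \<times> 'z) measure set" where
  "couplings \<mu> \<nu> = {\<pi>. prob_space \<pi> \<and> sets \<pi> = sets (\<mu> \<Otimes>\<^sub>M \<nu>) \<and>
     distr \<pi> \<mu> fst = \<mu> \<and> distr \<pi> \<nu> snd = \<nu>}"

text \<open>The Wasserstein-1 distance is extended-valued, so a finite upper bound on it is
  informative even when no finiteness of first moments has been assumed.\<close>

definition wasserstein1 :: "'z::metric_space measure \<Rightarrow> 'z measure \<Rightarrow> ennreal" where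
  "wasserstein1 \<mu> \<nu> = (INF \<pi>\<in>couplings \<mu> \<nu>. \<integral>\<^sup>+ (z, z'). ennreal (dist z z') \<partial>\<pi>)"

definition expected_loss :: "('a \<Rightarrow> 'z \<Rightarrow> real) \<Rightarrow> 'z measure \<Rightarrow> 'a \<Rightarrow> real" where
  "expected_loss loss M \<theta> = (LINT z|M. loss \<theta> z)"

text \<open>The gradient is taken within the parameter set, so a loss need not be defined outside it.
  Where such a gradient is not unique (parameter sets with empty interior), \<open>grad\<close> is an
  arbitrary choice of one.\<close>

definition loss_gradient ::
  "'a::euclidean_space set \<Rightarrow> 'z set \<Rightarrow> ('a \<Rightarrow> 'z \<Rightarrow> real) \<Rightarrow> ('a \<Rightarrow> 'z \<Rightarrow> 'a) \<Rightarrow> bool" where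
  "loss_gradient \<Theta> Z loss grad \<longleftrightarrow>
     (\<forall>z\<in>Z. \<forall>\<theta>\<in>\<Theta>. ((\<lambda>\<theta>'. loss \<theta>' z) has_derivative (\<lambda>h. grad \<theta> z \<bullet> h)) (at \<theta> within \<Theta>))"

definition strongly_convex_loss ::
  "real \<Rightarrow> 'a::euclidean_space set \<Rightarrow> 'z set \<Rightarrow> ('a \<Rightarrow> 'z \<Rightarrow> real) \<Rightarrow> ('a \<Rightarrow> 'z \<Rightarrow> 'a) \<Rightarrow> bool" where
  "strongly_convex_loss \<gamma> \<Theta> Z loss grad \<longleftrightarrow>
     (\<forall>z\<in>Z. \<forall>\<theta>\<in>\<Theta>. \<forall>\<theta>'\<in>\<Theta>.
        loss \<theta> z \<ge> loss \<theta>' z + grad \<theta>' z \<bullet> (\<theta> - \<theta>') + \<gamma> / 2 * (norm (\<theta> - \<theta>'))\<^sup>2)"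

definition smooth_loss ::
  "real \<Rightarrow> 'a::euclidean_space set \<Rightarrow> 'z::real_normed_vector set \<Rightarrow> ('a \<Rightarrow> 'z \<Rightarrow> 'a) \<Rightarrow> bool" where
  "smooth_loss L \<Theta> Z grad \<longleftrightarrow>
     (\<forall>\<theta>\<in>\<Theta>. \<forall>z\<in>Z. \<forall>z'\<in>Z. norm (grad \<theta> z - grad \<theta> z') \<le> L * norm (z - z')) \<and>
     (\<forall>z\<in>Z. \<forall>\<theta>\<in>\<Theta>. \<forall>\<theta>'\<in>\<Theta>. norm (grad \<theta> z - grad \<theta>' z) \<le> L * norm (\<theta> - \<theta>'))"

definition sensitive ::
  "real \<Rightarrow> 'a::euclidean_space set \<Rightarrow> 'b::euclidean_space set \<Rightarrow>
   ('a \<Rightarrow> 'b \<Rightarrow> 'z::metric_space measure) \<Rightarrow> bool" where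
  "sensitive \<epsilon> \<Theta> \<Phi> D \<longleftrightarrow>
     (\<forall>\<theta>\<in>\<Theta>. \<forall>\<theta>'\<in>\<Theta>. \<forall>\<phi>\<in>\<Phi>. \<forall>\<phi>'\<in>\<Phi>.
        wasserstein1 (D \<theta> \<phi>) (D \<theta>' \<phi>') \<le> ennreal (\<epsilon> * norm ((\<theta>, \<phi>) - (\<theta>', \<phi>'))))"

definition stable_point ::
  "'a set \<Rightarrow> 'b set \<Rightarrow> ('a \<Rightarrow> 'z \<Rightarrow> real) \<Rightarrow> ('b \<Rightarrow> 'z \<Rightarrow> real) \<Rightarrow>
   ('a \<Rightarrow> 'b \<Rightarrow> 'z measure) \<Rightarrow> ('a \<Rightarrow> 'b \<Rightarrow> 'z measure) \<Rightarrow> 'a \<Rightarrow> 'b \<Rightarrow> bool" where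
  "stable_point \<Theta> \<Phi> loss\<theta> loss\<phi> P Q \<theta> \<phi> \<longleftrightarrow>
     is_arg_min (expected_loss loss\<theta> (P \<theta> \<phi>)) (\<lambda>\<theta>'. \<theta>' \<in> \<Theta>) \<theta> \<and>
     is_arg_min (expected_loss loss\<phi> (Q \<theta> \<phi>)) (\<lambda>\<phi>'. \<phi>' \<in> \<Phi>) \<phi>"

datatype update_order = Synchronous | Theta_First | Phi_First

text \<open>A retrained parameter is given by Hilbert choice among the minimizers over the parameter
  set; for strongly convex losses there is exactly one. Every initial point in
  \<open>\<Theta> \<times> \<Phi>\<close> and every sequence of update orders thus determine the loop, and in particular
  a statement about all loops cannot be vacuous for lack of minimizers.\<close>

definition retrain :: "'a set \<Rightarrow> ('a \<Rightarrow> 'z \<Rightarrow> real) \<Rightarrow> 'z measure \<Rightarrow> 'a" where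
  "retrain \<Theta> loss M = arg_min_on (expected_loss loss M) \<Theta>"

definition training_loop ::
  "'a set \<Rightarrow> 'b set \<Rightarrow> ('a \<Rightarrow> 'z \<Rightarrow> real) \<Rightarrow> ('b \<Rightarrow> 'z \<Rightarrow> real) \<Rightarrow>
   ('a \<Rightarrow> 'b \<Rightarrow> 'z measure) \<Rightarrow> ('a \<Rightarrow> 'b \<Rightarrow> 'z measure) \<Rightarrow>
   (nat \<Rightarrow> update_order) \<Rightarrow> (nat \<Rightarrow> 'a) \<Rightarrow> (nat \<Rightarrow> 'b) \<Rightarrow> bool" where
  "training_loop \<Theta> \<Phi> loss\<theta> loss\<phi> P Q upd \<theta> \<phi> \<longleftrightarrow>
     \<theta> 0 \<in> \<Theta> \<and> \<phi> 0 \<in> \<Phi> \<and>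
     (\<forall>t. case upd t of
        Synchronous \<Rightarrow>
          \<theta> (Suc t) = retrain \<Theta> loss\<theta> (P (\<theta> t) (\<phi> t)) \<and>
          \<phi> (Suc t) = retrain \<Phi> loss\<phi> (Q (\<theta> t) (\<phi> t))
      | Theta_First \<Rightarrow>
          \<theta> (Suc t) = retrain \<Theta> loss\<theta> (P (\<theta> t) (\<phi> t)) \<and>
          \<phi> (Suc t) = retrain \<Phi> loss\<phi> (Q (\<theta> (Suc t)) (\<phi> t))
      | Phi_First \<Rightarrow>
          \<phi> (Suc t) = retrain \<Phi> loss\<phi> (Q (\<theta> t) (\<phi> t)) \<and>
          \<theta> (Suc t) = retrain \<Theta> loss\<theta> (P (\<theta> t) (\<phi> (Suc t))))"

end

theory Submission
  imports Defs
begin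

text \<open>Retraining a \<open>\<gamma>\<close>-strongly convex, \<open>L\<close>-smooth loss depends on the data distribution in a
  \<open>(L / \<gamma>)\<close>-Lipschitz way with respect to the Wasserstein-1 distance: if \<open>a\<close> and \<open>b\<close> minimize the
  expected losses \<open>f\<close> and \<open>g\<close> under two distributions, then adding the two quadratic growth
  estimates bounds \<open>\<gamma> \<parallel>a - b\<parallel>\<^sup>2\<close> by \<open>(f b - f a) - (g b - g a)\<close>, and the loss difference between
  \<open>a\<close> and \<open>b\<close> is \<open>(L \<parallel>a - b\<parallel>)\<close>-Lipschitz in the data. Hence the two retraining maps are Lipschitz
  with constants \<open>\<rho> = L\<^sub>\<theta> \<epsilon>\<^sub>\<theta> / \<gamma>\<^sub>\<theta>\<close> and \<open>\<sigma> = L\<^sub>\<phi> \<epsilon>\<^sub>\<phi> / \<gamma>\<^sub>\<phi>\<close>, where \<open>\<rho> + \<sigma> < 1\<close>.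
  Banach's fixed point theorem applied to the synchronous update yields the stable point, which is
  a fixed point of the asynchronous updates as well; these contract the distance to it by the
  factor \<open>\<rho> + \<sigma> + \<rho> \<sigma> \<le> \<kappa>\<close>.\<close>

section \<open>Lipschitz test functions and the Wasserstein-1 distance\<close>

lemma distribution_on_space: "distribution_on Z M \<Longrightarrow> space M = Z"
  unfolding distribution_on_def
  by (metis Int_UNIV_right sets_eq_imp_space_eq space_borel space_restrict_space inf_commute)

text \<open>This is the easy half of Kantorovich-Rubinstein duality. Both integrals are pulled back
  to a coupling along its marginals, and their difference is then at most \<open>K\<close> times the
  transport cost.\<close>

lemma wasserstein1_lipschitz_bound:
  fixes Z :: "'z::{metric_space, second_countable_topology} set"
  assumes M: "distribution_on Z M" and N: "distribution_on Z N"
    and g: "integrable M g" "integrable N g"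
    and lip: "\<And>z z'. z \<in> Z \<Longrightarrow> z' \<in> Z \<Longrightarrow> \<bar>g z - g z'\<bar> \<le> K * dist z z'"
    and K: "0 \<le> K" and \<delta>: "0 \<le> \<delta>" and W: "wasserstein1 M N \<le> ennreal \<delta>"
  shows "(LINT z|M. g z) - (LINT z|N. g z) \<le> K * \<delta>"
proof -
  \<comment> \<open>No optimal coupling is at hand, so the slack \<open>e\<close> selects one of
    cost below \<open>\<delta> + e\<close>; the limit \<open>e\<close> to 0 follows at the
    end.\<close>
  have *: "(LINT z|M. g z) - (LINT z|N. g z) \<le> K * (\<delta> + e)" if e: "0 < e" for e
  proof -
    have "wasserstein1 M N < ennreal (\<delta> + e)"
      using W e \<delta> by (simp add: ennreal_lessI order_le_less_trans)
    then obtain \<pi> where \<pi>: "\<pi> \<in> couplings M N"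
      and less: "(\<integral>\<^sup>+ (z, z'). ennreal (dist z z') \<partial>\<pi>) < ennreal (\<delta> + e)"
      unfolding wasserstein1_def by (auto simp: INF_less_iff)
    have sets_\<pi>[measurable_cong]: "sets \<pi> = sets (M \<Otimes>\<^sub>M N)"
      and dM: "distr \<pi> M fst = M" and dN: "distr \<pi> N snd = N"
      using \<pi> by (auto simp: couplings_def)
    have sM[measurable_cong]: "sets M = sets (restrict_space borel Z)"
      and sN[measurable_cong]: "sets N = sets (restrict_space borel Z)"
      using M N by (auto simp: distribution_on_def)
    have space_\<pi>: "space \<pi> = Z \<times> Z"
      using sets_eq_imp_space_eq[OF sets_\<pi>] distribution_on_space[OF M] distribution_on_space[OF N]
      by (simp add: space_pair_measure)
    have fstM: "fst \<in> measurable \<pi> M" and sndN: "snd \<in> measurable \<pi> N"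
      by measurable
    \<comment> \<open>The measures carry the sigma-algebra of \<open>restrict_space borel Z\<close>.
      Measurability of \<open>dist\<close> on the coupling needs projections that are measurable
      into \<open>borel\<close> itself.\<close>
    have "(\<lambda>z. z) \<in> borel_measurable M" "(\<lambda>z. z) \<in> borel_measurable N"
      using measurable_restrict_space1[OF measurable_ident_sets[OF refl], of borel Z]
        measurable_cong_sets[OF sM refl, of borel] measurable_cong_sets[OF sN refl, of borel]
      by simp_all
    then have [measurable]: "fst \<in> borel_measurable \<pi>" "snd \<in> borel_measurable \<pi>"
      using measurable_compose[OF fstM] measurable_compose[OF sndN] by simp_all
    have i1: "integrable \<pi> (\<lambda>p. g (fst p))" and e1: "(LINT z|M. g z) = (LINT p|\<pi>. g (fst p))"
      using g(1) integrable_distr_eq[OF fstM, of g] integral_distr[OF fstM, of g] dM by auto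
    have i2: "integrable \<pi> (\<lambda>p. g (snd p))" and e2: "(LINT z|N. g z) = (LINT p|\<pi>. g (snd p))"
      using g(2) integrable_distr_eq[OF sndN, of g] integral_distr[OF sndN, of g] dN by auto
    define I where "I = (LINT z|M. g z) - (LINT z|N. g z)"
    have I: "I = (LINT p|\<pi>. g (fst p) - g (snd p))"
      unfolding I_def e1 e2 using i1 i2 by simp
    have "ennreal \<bar>I\<bar> \<le> (\<integral>\<^sup>+ p. ennreal \<bar>g (fst p) - g (snd p)\<bar> \<partial>\<pi>)"
      unfolding I using integral_norm_bound_ennreal[OF Bochner_Integration.integrable_diff[OF i1 i2]]
      by simp
    also have "\<dots> \<le> (\<integral>\<^sup>+ p. ennreal K * ennreal (dist (fst p) (snd p)) \<partial>\<pi>)"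
      by (intro nn_integral_mono)
        (auto simp: space_\<pi> K simp flip: ennreal_mult intro!: ennreal_leI lip)
    also have "\<dots> = ennreal K * (\<integral>\<^sup>+ (z, z'). ennreal (dist z z') \<partial>\<pi>)"
      by (subst nn_integral_cmult) (auto simp: case_prod_beta')
    also have "\<dots> \<le> ennreal K * ennreal (\<delta> + e)"
      using less by (intro mult_left_mono) auto
    also have "\<dots> = ennreal (K * (\<delta> + e))"
      using K \<delta> e by (simp add: ennreal_mult)
    finally have "\<bar>I\<bar> \<le> K * (\<delta> + e)"
      using K \<delta> e by simp
    then show ?thesis unfolding I_def by simp
  qed
  have "((\<lambda>e. K * (\<delta> + e)) \<longlongrightarrow> K * (\<delta> + 0)) (at_right 0)"
    by (intro tendsto_intros)
  then have "(LINT z|M. g z) - (LINT z|N. g z) \<le> K * (\<delta> + 0)"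
    by (rule tendsto_lowerbound[OF _ eventually_mono[OF eventually_at_right_less *]]) simp_all
  then show ?thesis by simp
qed

section \<open>Pointwise consequences of smoothness\<close>

lemma onorm_inner_right_le: "onorm (\<lambda>h. (v::'a::real_inner) \<bullet> h) \<le> norm v"
  by (rule onorm_bound) (simp_all add: Cauchy_Schwarz_ineq2)

locale strongly_convex_learning =
  fixes \<Theta> :: "'a::euclidean_space set" and Z :: "'z::euclidean_space set"
    and loss :: "'a \<Rightarrow> 'z \<Rightarrow> real" and grad :: "'a \<Rightarrow> 'z \<Rightarrow> 'a" and \<gamma> L :: real
  assumes closed: "closed \<Theta>" and convex: "convex \<Theta>" and nonempty: "\<Theta> \<noteq> {}"
    and \<gamma>_pos: "0 < \<gamma>" and L_nonneg: "0 \<le> L"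
    and gradient: "loss_gradient \<Theta> Z loss grad"
    and strongly_convex: "strongly_convex_loss \<gamma> \<Theta> Z loss grad"
    and smooth: "smooth_loss L \<Theta> Z grad"
begin

lemma segment_in: "a \<in> \<Theta> \<Longrightarrow> b \<in> \<Theta> \<Longrightarrow> 0 \<le> s \<Longrightarrow> s \<le> 1 \<Longrightarrow> a + s *\<^sub>R (b - a) \<in> \<Theta>"
  using convexD_alt[OF convex, of a b s] by (simp add: algebra_simps)

text \<open>For fixed \<open>z\<close> and \<open>z'\<close>, the map
  \<open>\<lambda>\<theta>. loss \<theta> z - loss \<theta> z'\<close> has its derivative bounded by
  \<open>L * norm (z - z')\<close>, by smoothness in the data. The mean value inequality on the
  convex set \<open>\<Theta>\<close> gives the claim after regrouping.\<close>

lemma loss_difference_lipschitz: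
  assumes "a \<in> \<Theta>" "b \<in> \<Theta>" "z \<in> Z" "z' \<in> Z"
  shows "\<bar>(loss b z - loss a z) - (loss b z' - loss a z')\<bar> \<le> L * norm (b - a) * dist z z'"
proof -
  have "norm ((loss b z - loss b z') - (loss a z - loss a z')) \<le> (L * norm (z - z')) * norm (b - a)"
  proof (rule differentiable_bound[OF convex])
    fix x assume x: "x \<in> \<Theta>"
    show "((\<lambda>\<theta>. loss \<theta> z - loss \<theta> z') has_derivative (\<lambda>h. (grad x z - grad x z') \<bullet> h)) (at x within \<Theta>)"
      using gradient x assms unfolding loss_gradient_def inner_diff_left
      by (intro has_derivative_diff) auto
    show "onorm (\<lambda>h. (grad x z - grad x z') \<bullet> h) \<le> L * norm (z - z')"
      using smooth x assms unfolding smooth_loss_def by (meson onorm_inner_right_le order_trans)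
  qed (use assms in auto)
  then show ?thesis by (simp add: dist_norm algebra_simps)
qed

text \<open>The mean value inequality is applied to the loss minus its linearization at
  \<open>a\<close>. It yields the constant \<open>L\<close> where integrating along the segment
  would yield \<open>L / 2\<close>; only the quadratic order matters later.\<close>

lemma loss_taylor:
  assumes "a \<in> \<Theta>" "b \<in> \<Theta>" "z \<in> Z"
  shows "\<bar>loss b z - loss a z - grad a z \<bullet> (b - a)\<bar> \<le> L * (norm (b - a))\<^sup>2"
proof -
  have sub: "closed_segment a b \<subseteq> \<Theta>"
    using convex assms by (simp add: closed_segment_subset)
  have "norm ((loss b z - grad a z \<bullet> b) - (loss a z - grad a z \<bullet> a)) \<le> (L * norm (b - a)) * norm (b - a)"
  \<comment> \<open>On the segment, unlike on all of \<open>\<Theta>\<close>,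
    \<open>norm (x - a)\<close> is at most \<open>norm (b - a)\<close>, which makes the derivative
    bound uniform.\<close>
  proof (rule differentiable_bound[OF convex_closed_segment])
    fix x assume x: "x \<in> closed_segment a b"
    then have xT: "x \<in> \<Theta>" using sub by auto
    have "((\<lambda>\<theta>. loss \<theta> z) has_derivative (\<lambda>h. grad x z \<bullet> h)) (at x within \<Theta>)"
      using gradient xT assms unfolding loss_gradient_def by auto
    then have "((\<lambda>\<theta>. loss \<theta> z) has_derivative (\<lambda>h. grad x z \<bullet> h)) (at x within closed_segment a b)"
      using sub by (rule has_derivative_subset)
    then show "((\<lambda>\<theta>. loss \<theta> z - grad a z \<bullet> \<theta>) has_derivative (\<lambda>h. (grad x z - grad a z) \<bullet> h))
        (at x within closed_segment a b)"
      unfolding inner_diff_left by (intro derivative_intros)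
    have "norm (grad x z - grad a z) \<le> L * norm (x - a)"
      using smooth xT assms unfolding smooth_loss_def by auto
    also have "\<dots> \<le> L * norm (b - a)"
      using segment_bound1[OF x] L_nonneg by (simp add: mult_left_mono)
    finally show "onorm (\<lambda>h. (grad x z - grad a z) \<bullet> h) \<le> L * norm (b - a)"
      using onorm_inner_right_le order_trans by blast
  qed auto
  then show ?thesis by (simp add: inner_diff_right power2_eq_square algebra_simps)
qed

end

section \<open>Expected loss under one fixed distribution\<close>

locale learning_distribution = strongly_convex_learning +
  fixes M
  assumes distribution: "distribution_on Z M"
    and integrable_loss: "\<theta> \<in> \<Theta> \<Longrightarrow> integrable M (loss \<theta>)"
begin

sublocale prob_space M
  using distribution by (simp add: distribution_on_def)

lemma space_M: "space M = Z"
  by (rule distribution_on_space[OF distribution])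

text \<open>Nothing is assumed about measurability of \<open>grad\<close> in the data. Along a
  direction pointing into \<open>\<Theta>\<close>, however, it is a pointwise limit of difference
  quotients of the loss, hence measurable, and \<open>loss_taylor\<close> supplies an integrable
  bound.\<close>

lemma integrable_directional_gradient:
  assumes a: "a \<in> \<Theta>" and b: "b \<in> \<Theta>"
  shows "integrable M (\<lambda>z. grad a z \<bullet> (b - a))"
proof -
  \<comment> \<open>Step sizes in (0, 1] keep the evaluation points on the segment from
    \<open>a\<close> to \<open>b\<close>, hence in \<open>\<Theta>\<close>.\<close>
  define s where "s n = inverse (real (Suc n))" for n
  have s: "0 < s n" "s n \<le> 1" for n
    by (auto simp: s_def divide_simps)
  have meas: "(\<lambda>z. grad a z \<bullet> (b - a)) \<in> borel_measurable M"
  proof (rule borel_measurable_LIMSEQ_real)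
    fix z assume "z \<in> space M"
    then have z: "z \<in> Z" by (simp add: space_M)
    show "(\<lambda>n. (loss (a + s n *\<^sub>R (b - a)) z - loss a z) / s n) \<longlonglongrightarrow> grad a z \<bullet> (b - a)"
    proof (rule Lim_transform2[OF tendsto_const], rule tendsto_0_le[where K = 1])
      show "(\<lambda>n. L * (norm (b - a))\<^sup>2 * s n) \<longlonglongrightarrow> 0"
        unfolding s_def by (rule tendsto_mult_right_zero[OF LIMSEQ_inverse_real_of_nat])
      \<comment> \<open>This is \<open>loss_taylor\<close> at step size \<open>s n\<close>, divided
        by \<open>s n\<close>: the quadratic remainder leaves an error of first order in
        \<open>s n\<close>.\<close>
      have "\<bar>grad a z \<bullet> (b - a) - (loss (a + s n *\<^sub>R (b - a)) z - loss a z) / s n\<bar> \<le> L * (norm (b - a))\<^sup>2 * s n" for n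
      proof -
        have "\<bar>loss (a + s n *\<^sub>R (b - a)) z - loss a z - s n * (grad a z \<bullet> (b - a))\<bar> \<le> L * (s n * norm (b - a))\<^sup>2"
          using loss_taylor[OF a segment_in[OF a b less_imp_le[OF s(1)] s(2)] z, of n] s(1)[of n] by simp
        then have "\<bar>(loss (a + s n *\<^sub>R (b - a)) z - loss a z - s n * (grad a z \<bullet> (b - a))) / s n\<bar> \<le> L * (s n * norm (b - a))\<^sup>2 / s n"
          using s(1)[of n] by (simp add: divide_right_mono)
        then show ?thesis
          using s(1)[of n] by (simp add: diff_divide_distrib power2_eq_square ac_simps abs_minus_commute)
      qed
      then show "\<forall>\<^sub>F n in sequentially. norm (grad a z \<bullet> (b - a) - (loss (a + s n *\<^sub>R (b - a)) z - loss a z) / s n)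
          \<le> norm (L * (norm (b - a))\<^sup>2 * s n) * 1"
        by (intro always_eventually allI) (use L_nonneg s in \<open>auto intro: order_trans[OF _ abs_ge_self]\<close>)
    qed
  next
    fix n
    show "(\<lambda>z. (loss (a + s n *\<^sub>R (b - a)) z - loss a z) / s n) \<in> borel_measurable M"
      using integrable_loss[OF a] integrable_loss[OF segment_in[OF a b less_imp_le[OF s(1)] s(2)], of n]
      by measurable
  qed
  show ?thesis
  proof (rule Bochner_Integration.integrable_bound[OF _ meas])
    show "integrable M (\<lambda>z. \<bar>loss b z - loss a z\<bar> + L * (norm (b - a))\<^sup>2)"
      using integrable_loss[OF a] integrable_loss[OF b] by simp
    show "AE z in M. norm (grad a z \<bullet> (b - a)) \<le> norm (\<bar>loss b z - loss a z\<bar> + L * (norm (b - a))\<^sup>2)"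
      by (intro AE_I2) (use loss_taylor[OF a b] in \<open>force simp: space_M\<close>)
  qed
qed

text \<open>\<open>grad a\<close> itself need not be integrable, because it is unconstrained in directions orthogonal
  to \<open>\<Theta>\<close>; so the expected gradient is built on the subspace of integrable directions.\<close>

lemma expected_gradient:
  assumes a: "a \<in> \<Theta>"
  shows "\<exists>c. \<forall>b\<in>\<Theta>. (LINT z|M. grad a z \<bullet> (b - a)) = c \<bullet> (b - a)"
proof -
  define S where "S = {h. integrable M (\<lambda>z. grad a z \<bullet> h)}"
  have "subspace S"
    by (auto simp: subspace_def S_def inner_add_right)
  then obtain B where B: "B \<subseteq> S" "pairwise orthogonal B" "\<And>x. x \<in> B \<Longrightarrow> norm x = 1"
    "independent B" "card B = dim S" "span B = S"
    using orthonormal_basis_subspace by metis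
  have fin: "finite B" using B(4) by (rule independent_imp_finite)
  \<comment> \<open>The Riesz representative of the linear functional
    \<open>\<lambda>h. LINT z|M. grad a z \<bullet> h\<close> on \<open>S\<close>, given by its
    coordinates in the orthonormal basis \<open>B\<close>.\<close>
  define c where "c = (\<Sum>i\<in>B. (LINT z|M. grad a z \<bullet> i) *\<^sub>R i)"
  have "(LINT z|M. grad a z \<bullet> (b - a)) = c \<bullet> (b - a)" if b: "b \<in> \<Theta>" for b
  proof -
    define h where "h = b - a"
    have "h \<in> S" using integrable_directional_gradient[OF a b] by (simp add: S_def h_def)
    then have h: "(\<Sum>i\<in>B. (h \<bullet> i) *\<^sub>R i) = h"
      using orthonormal_basis_expand[OF B(2,3) _ fin, of h] B(6) by simp
    have "(LINT z|M. grad a z \<bullet> h) = (LINT z|M. (\<Sum>i\<in>B. (h \<bullet> i) * (grad a z \<bullet> i)))"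
      by (subst h[symmetric]) (simp add: inner_sum_right)
    also have "\<dots> = (\<Sum>i\<in>B. (h \<bullet> i) * (LINT z|M. grad a z \<bullet> i))"
      using B(1) by (subst Bochner_Integration.integral_sum) (auto simp: S_def)
    also have "\<dots> = c \<bullet> h"
      by (simp add: c_def inner_sum_left inner_commute[of h] mult.commute)
    finally show ?thesis by (simp add: h_def)
  qed
  then show ?thesis by blast
qed

text \<open>Integrates strong convexity and \<open>loss_taylor\<close>, with \<open>c\<close> as
  expected gradient. Continuity, existence of a minimizer and first-order optimality are all derived
  from these two bounds, without differentiating under the integral.\<close>

lemma expected_loss_quadratic_bounds:
  assumes a: "a \<in> \<Theta>"
  shows "\<exists>c. \<forall>b\<in>\<Theta>.
    expected_loss loss M a + c \<bullet> (b - a) + \<gamma> / 2 * (norm (b - a))\<^sup>2 \<le> expected_loss loss M b \<and>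
    expected_loss loss M b \<le> expected_loss loss M a + c \<bullet> (b - a) + L * (norm (b - a))\<^sup>2"
proof -
  obtain c where c: "\<And>b. b \<in> \<Theta> \<Longrightarrow> (LINT z|M. grad a z \<bullet> (b - a)) = c \<bullet> (b - a)"
    using expected_gradient[OF a] by blast
  \<comment> \<open>Both bounds integrate to this shape, with \<open>k\<close> the quadratic term,
    which is constant in \<open>z\<close>.\<close>
  have eq: "(LINT z|M. loss a z + grad a z \<bullet> (b - a) + k) = expected_loss loss M a + c \<bullet> (b - a) + k"
    and int: "integrable M (\<lambda>z. loss a z + grad a z \<bullet> (b - a) + k)" if "b \<in> \<Theta>" for b k
    using integrable_loss[OF a] integrable_directional_gradient[OF a that] c[OF that]
    by (simp_all add: expected_loss_def prob_space)
  show ?thesis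
  proof (intro exI[of _ c] ballI conjI)
    fix b assume b: "b \<in> \<Theta>"
    show "expected_loss loss M a + c \<bullet> (b - a) + \<gamma> / 2 * (norm (b - a))\<^sup>2 \<le> expected_loss loss M b"
      unfolding eq[OF b, symmetric] unfolding expected_loss_def
      using strongly_convex a b unfolding strongly_convex_loss_def
      by (intro integral_mono int integrable_loss) (auto simp: space_M)
    show "expected_loss loss M b \<le> expected_loss loss M a + c \<bullet> (b - a) + L * (norm (b - a))\<^sup>2"
      unfolding eq[OF b, symmetric] unfolding expected_loss_def
      by (intro integral_mono int integrable_loss b)
        (use loss_taylor[OF a b] in \<open>force simp: space_M\<close>)
  qed
qed

lemma continuous_on_expected_loss: "continuous_on \<Theta> (expected_loss loss M)"
unfolding continuous_on_def
proof
  fix a assume a: "a \<in> \<Theta>"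
  obtain c where
    c: "\<And>b. b \<in> \<Theta> \<Longrightarrow> expected_loss loss M a + c \<bullet> (b - a) + \<gamma> / 2 * (norm (b - a))\<^sup>2 \<le> expected_loss loss M b"
    "\<And>b. b \<in> \<Theta> \<Longrightarrow> expected_loss loss M b \<le> expected_loss loss M a + c \<bullet> (b - a) + L * (norm (b - a))\<^sup>2"
    using expected_loss_quadratic_bounds[OF a] by blast
  show "(expected_loss loss M \<longlongrightarrow> expected_loss loss M a) (at a within \<Theta>)"
  proof (rule tendsto_sandwich)
    show "\<forall>\<^sub>F b in at a within \<Theta>. expected_loss loss M a + c \<bullet> (b - a) + \<gamma> / 2 * (norm (b - a))\<^sup>2 \<le> expected_loss loss M b"
      "\<forall>\<^sub>F b in at a within \<Theta>. expected_loss loss M b \<le> expected_loss loss M a + c \<bullet> (b - a) + L * (norm (b - a))\<^sup>2"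
      using c by (auto simp: eventually_at_filter)
    have "((\<lambda>b. expected_loss loss M a + c \<bullet> (b - a) + k * (norm (b - a))\<^sup>2) \<longlongrightarrow>
        expected_loss loss M a + c \<bullet> (a - a) + k * (norm (a - a))\<^sup>2) (at a within \<Theta>)" for k
      by (intro tendsto_intros)
    from this[of "\<gamma> / 2"] this[of L] show "((\<lambda>b. expected_loss loss M a + c \<bullet> (b - a) + \<gamma> / 2 * (norm (b - a))\<^sup>2) \<longlongrightarrow> expected_loss loss M a) (at a within \<Theta>)"
      "((\<lambda>b. expected_loss loss M a + c \<bullet> (b - a) + L * (norm (b - a))\<^sup>2) \<longlongrightarrow> expected_loss loss M a) (at a within \<Theta>)"
      by auto
  qed
qed

text \<open>Strong convexity makes the expected loss coercive, so the search reduces to the compact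
  set \<open>\<Theta> \<inter> cball a R\<close>, on which a continuous function attains its
  minimum.\<close>

lemma ex_minimizer: "\<exists>a. is_arg_min (expected_loss loss M) (\<lambda>\<theta>. \<theta> \<in> \<Theta>) a"
proof -
  let ?f = "expected_loss loss M"
  from nonempty obtain a where a: "a \<in> \<Theta>" by auto
  obtain c where
    c: "\<And>b. b \<in> \<Theta> \<Longrightarrow> ?f a + c \<bullet> (b - a) + \<gamma> / 2 * (norm (b - a))\<^sup>2 \<le> ?f b"
    "\<And>b. b \<in> \<Theta> \<Longrightarrow> ?f b \<le> ?f a + c \<bullet> (b - a) + L * (norm (b - a))\<^sup>2"
    using expected_loss_quadratic_bounds[OF a] by blast
  \<comment> \<open>Beyond this radius the term \<open>\<gamma> / 2 * (norm (b - a))\<^sup>2\<close>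
    outweighs the worst linear decrease \<open>norm c * norm (b - a)\<close>.\<close>
  define R where "R = 2 * norm c / \<gamma>"
  have R: "0 \<le> R" using \<gamma>_pos by (simp add: R_def)
  have far: "?f a \<le> ?f b" if b: "b \<in> \<Theta>" and "R < norm (b - a)" for b
  proof -
    have "norm c * norm (b - a) \<le> (\<gamma> / 2 * norm (b - a)) * norm (b - a)"
      using that \<gamma>_pos by (intro mult_right_mono) (auto simp: R_def field_simps)
    moreover have "- (norm c * norm (b - a)) \<le> c \<bullet> (b - a)"
      using Cauchy_Schwarz_ineq2[of c "b - a"] by linarith
    ultimately show ?thesis using c(1)[OF b] by (simp add: power2_eq_square)
  qed
  have "compact (\<Theta> \<inter> cball a R)" using closed by (simp add: closed_Int_compact)
  moreover have "a \<in> \<Theta> \<inter> cball a R" using a R by simp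
  moreover have "continuous_on (\<Theta> \<inter> cball a R) ?f"
    using continuous_on_expected_loss by (rule continuous_on_subset) auto
  ultimately obtain m where m: "m \<in> \<Theta> \<inter> cball a R" "\<And>b. b \<in> \<Theta> \<inter> cball a R \<Longrightarrow> ?f m \<le> ?f b"
    using continuous_attains_inf[of "\<Theta> \<inter> cball a R" ?f] by blast
  have "?f m \<le> ?f b" if b: "b \<in> \<Theta>" for b
  proof (cases "norm (b - a) \<le> R")
    case True
    then show ?thesis using b m(2) by (simp add: dist_norm norm_minus_commute)
  next
    case False
    then have "?f a \<le> ?f b" using far[OF b] by simp
    then show ?thesis using m(2)[of a] a R by simp
  qed
  then show ?thesis using m(1) by (auto simp: is_arg_min_linorder)
qed

lemma retrain_is_arg_min:
  "is_arg_min (expected_loss loss M) (\<lambda>\<theta>. \<theta> \<in> \<Theta>) (retrain \<Theta> loss M)"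
  unfolding retrain_def arg_min_on_def arg_min_def using ex_minimizer by (rule someI_ex)

lemma retrain_in: "retrain \<Theta> loss M \<in> \<Theta>"
  using retrain_is_arg_min by (simp add: is_arg_min_def)

lemma quadratic_growth:
  assumes b: "b \<in> \<Theta>"
  defines "a \<equiv> retrain \<Theta> loss M"
  shows "expected_loss loss M a + \<gamma> / 2 * (norm (b - a))\<^sup>2 \<le> expected_loss loss M b"
proof -
  let ?f = "expected_loss loss M"
  have a: "a \<in> \<Theta>" and min: "\<And>x. x \<in> \<Theta> \<Longrightarrow> ?f a \<le> ?f x"
    using retrain_is_arg_min unfolding a_def by (auto simp: is_arg_min_linorder)
  obtain c where
    c: "\<And>b. b \<in> \<Theta> \<Longrightarrow> ?f a + c \<bullet> (b - a) + \<gamma> / 2 * (norm (b - a))\<^sup>2 \<le> ?f b"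
    "\<And>b. b \<in> \<Theta> \<Longrightarrow> ?f b \<le> ?f a + c \<bullet> (b - a) + L * (norm (b - a))\<^sup>2"
    using expected_loss_quadratic_bounds[OF a] by blast
  \<comment> \<open>Moving from \<open>a\<close> a fraction \<open>s\<close> towards
    \<open>b\<close> cannot lower the loss; the upper quadratic bound is divided by
    \<open>s\<close>, and then \<open>s\<close> tends to 0.\<close>
  have "0 \<le> c \<bullet> (b - a) + s * (L * (norm (b - a))\<^sup>2)" if s: "0 < s" "s < 1" for s
  proof -
    have x: "a + s *\<^sub>R (b - a) \<in> \<Theta>" using segment_in[OF a b] s by simp
    have "0 \<le> s * (c \<bullet> (b - a)) + L * (s * norm (b - a))\<^sup>2"
      using order_trans[OF min[OF x] c(2)[OF x]] s by simp
    also have "\<dots> = s * (c \<bullet> (b - a) + s * (L * (norm (b - a))\<^sup>2))"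
      by (simp add: power2_eq_square algebra_simps)
    finally show ?thesis using s by (simp add: zero_le_mult_iff)
  qed
  then have ev: "\<forall>\<^sub>F s in at_right 0. 0 \<le> c \<bullet> (b - a) + s * (L * (norm (b - a))\<^sup>2)"
    unfolding eventually_at_right_field by (intro exI[of _ 1]) auto
  have "((\<lambda>s. c \<bullet> (b - a) + s * (L * (norm (b - a))\<^sup>2)) \<longlongrightarrow> c \<bullet> (b - a) + 0 * (L * (norm (b - a))\<^sup>2)) (at_right 0)"
    by (intro tendsto_intros)
  then have "0 \<le> c \<bullet> (b - a) + 0 * (L * (norm (b - a))\<^sup>2)"
    by (rule tendsto_lowerbound[OF _ ev]) (rule trivial_limit_at_right_real)
  then have "0 \<le> c \<bullet> (b - a)" by simp
  then show ?thesis using c(1)[OF b] by simp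
qed

end

section \<open>Dependence of the retrained parameter on the distribution\<close>

context strongly_convex_learning
begin

lemma retrain_stability:
  assumes M: "learning_distribution \<Theta> Z loss grad \<gamma> L M"
    and N: "learning_distribution \<Theta> Z loss grad \<gamma> L N"
    and \<delta>: "0 \<le> \<delta>" and W: "wasserstein1 M N \<le> ennreal \<delta>"
  shows "dist (retrain \<Theta> loss M) (retrain \<Theta> loss N) \<le> L * \<delta> / \<gamma>"
proof -
  interpret M: learning_distribution \<Theta> Z loss grad \<gamma> L M by (rule M)
  interpret N: learning_distribution \<Theta> Z loss grad \<gamma> L N by (rule N)
  define a where "a = retrain \<Theta> loss M"
  define b where "b = retrain \<Theta> loss N"
  have a: "a \<in> \<Theta>" and b: "b \<in> \<Theta>" by (simp_all add: a_def b_def M.retrain_in N.retrain_in)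
  have "\<gamma> * (norm (b - a))\<^sup>2 \<le> (expected_loss loss M b - expected_loss loss M a)
      - (expected_loss loss N b - expected_loss loss N a)"
    using M.quadratic_growth[OF b] N.quadratic_growth[OF a]
    by (simp add: a_def[symmetric] b_def[symmetric] norm_minus_commute)
  also have "\<dots> = (LINT z|M. loss b z - loss a z) - (LINT z|N. loss b z - loss a z)"
    unfolding expected_loss_def using a b by (simp add: M.integrable_loss N.integrable_loss)
  also have "\<dots> \<le> (L * norm (b - a)) * \<delta>"
    using a b L_nonneg
    by (intro wasserstein1_lipschitz_bound[OF M.distribution N.distribution _ _ _ _ \<delta> W]
        loss_difference_lipschitz Bochner_Integration.integrable_diff M.integrable_loss N.integrable_loss)
      auto
  finally have "norm (b - a) * (\<gamma> * norm (b - a)) \<le> norm (b - a) * (L * \<delta>)"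
    by (simp add: power2_eq_square algebra_simps)
  \<comment> \<open>One factor \<open>norm (b - a)\<close> is cancelled; if it vanishes, the claim
    is just nonnegativity of \<open>L * \<delta>\<close>.\<close>
  then have "\<gamma> * norm (b - a) \<le> L * \<delta>"
    using L_nonneg \<delta> by (cases "norm (b - a) = 0") auto
  then show ?thesis
    using \<gamma>_pos by (simp add: field_simps a_def b_def dist_norm norm_minus_commute)
qed

end

section \<open>Contraction factors and linear rates\<close>

lemma dist_Pair_le: "dist (a, b) (c, d) \<le> dist a c + dist b d"
  by (simp add: dist_Pair_Pair sqrt_sum_squares_le_sum)

text \<open>The second update sees the mixed pair \<open>(x', y)\<close>, whose distance to the
  fixed point is at most \<open>1 + \<rho>\<close> times the old one. This adds the cross term
  \<open>\<rho> * \<sigma>\<close> to the synchronous factor.\<close>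

lemma asynchronous_contraction:
  fixes x x' :: "'a::metric_space" and y y' :: "'b::metric_space"
  assumes x: "dist x' xs \<le> \<rho> * dist (x, y) (xs, ys)"
    and y: "dist y' ys \<le> \<sigma> * dist (x', y) (xs, ys)"
    and nonneg: "0 \<le> \<rho>" "0 \<le> \<sigma>"
  shows "dist x' xs + dist y' ys \<le> (\<rho> + \<sigma> + \<rho> * \<sigma>) * dist (x, y) (xs, ys)"
proof -
  let ?r = "dist (x, y) (xs, ys)"
  have "dist y ys \<le> ?r" using dist_snd_le[of "(x, y)" "(xs, ys)"] by simp
  then have "dist (x', y) (xs, ys) \<le> \<rho> * ?r + ?r"
    using x dist_Pair_le[of x' y xs ys] by linarith
  then have "dist y' ys \<le> \<sigma> * (\<rho> * ?r + ?r)"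
    using y nonneg by (meson mult_left_mono order_trans)
  then show ?thesis using x by (simp add: algebra_simps)
qed

text \<open>The right-hand side is the first entry of the maximum defining \<open>\<kappa>\<close>,
  rewritten in \<open>\<rho>\<close> and \<open>\<sigma>\<close>. Clearing the denominator leaves a
  visibly nonnegative gap.\<close>

lemma asynchronous_rate_le:
  fixes \<rho> \<sigma> :: real
  assumes "0 \<le> \<rho>" "\<rho> < 1" "0 \<le> \<sigma>"
  shows "\<rho> + \<sigma> + \<rho> * \<sigma> \<le> (\<sigma> + 2 * \<rho>) / (1 - \<rho>)"
proof -
  have "(\<rho> + \<sigma> + \<rho> * \<sigma>) * (1 - \<rho>) = \<sigma> + 2 * \<rho> - (\<rho> + \<rho> * \<rho> + \<rho> * \<rho> * \<sigma>)"
    by (simp add: algebra_simps)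
  moreover have "0 \<le> \<rho> + \<rho> * \<rho> + \<rho> * \<rho> * \<sigma>" using assms by simp
  ultimately have "(\<rho> + \<sigma> + \<rho> * \<sigma>) * (1 - \<rho>) \<le> \<sigma> + 2 * \<rho>" by linarith
  then show ?thesis using assms by (subst pos_le_divide_eq) auto
qed

lemma linear_rate_tendsto:
  fixes x :: "nat \<Rightarrow> 'a::metric_space"
  assumes "0 \<le> \<kappa>" "\<kappa> < 1" "\<And>t. dist (x t) l \<le> \<kappa> ^ t * C"
  shows "x \<longlonglongrightarrow> l"
proof (rule tendsto_dist_iff[THEN iffD2])
  show "(\<lambda>t. dist (x t) l) \<longlonglongrightarrow> 0"
  proof (rule tendsto_sandwich[where f = "\<lambda>_. 0"])
    show "(\<lambda>t. \<kappa> ^ t * C) \<longlonglongrightarrow> 0"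
      using assms by (intro tendsto_mult_left_zero LIMSEQ_power_zero) auto
  qed (use assms(3) in \<open>auto intro: always_eventually tendsto_const\<close>)
qed

section \<open>The stable point and convergence of the training loop\<close>

theorem theorem3p6:
  fixes \<Theta> :: "'a::euclidean_space set" and \<Phi> :: "'b::euclidean_space set"
    and X :: "'x::euclidean_space set" and Y :: "'y::euclidean_space set"
    and loss\<theta> :: "'a \<Rightarrow> 'x \<times> 'y \<Rightarrow> real" and grad\<theta> :: "'a \<Rightarrow> 'x \<times> 'y \<Rightarrow> 'a"
    and loss\<phi> :: "'b \<Rightarrow> 'x \<times> 'y \<Rightarrow> real" and grad\<phi> :: "'b \<Rightarrow> 'x \<times> 'y \<Rightarrow> 'b"
    and P Q :: "'a \<Rightarrow> 'b \<Rightarrow> ('x \<times> 'y) measure"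
    and \<gamma>\<theta> \<gamma>\<phi> L\<theta> L\<phi> \<epsilon>\<theta> \<epsilon>\<phi> \<kappa> :: real
  assumes "closed \<Theta>" "convex \<Theta>" "\<Theta> \<noteq> {}"
    and "closed \<Phi>" "convex \<Phi>" "\<Phi> \<noteq> {}"
    and "\<And>\<theta> \<phi>. \<theta> \<in> \<Theta> \<Longrightarrow> \<phi> \<in> \<Phi> \<Longrightarrow> distribution_on (X \<times> Y) (P \<theta> \<phi>)"
    and "\<And>\<theta> \<phi>. \<theta> \<in> \<Theta> \<Longrightarrow> \<phi> \<in> \<Phi> \<Longrightarrow> distribution_on (X \<times> Y) (Q \<theta> \<phi>)"
    and "\<And>\<theta> \<phi> \<theta>'. \<theta> \<in> \<Theta> \<Longrightarrow> \<phi> \<in> \<Phi> \<Longrightarrow> \<theta>' \<in> \<Theta> \<Longrightarrow> integrable (P \<theta> \<phi>) (loss\<theta> \<theta>')"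
    and "\<And>\<theta> \<phi> \<phi>'. \<theta> \<in> \<Theta> \<Longrightarrow> \<phi> \<in> \<Phi> \<Longrightarrow> \<phi>' \<in> \<Phi> \<Longrightarrow> integrable (Q \<theta> \<phi>) (loss\<phi> \<phi>')"
    and "0 < \<gamma>\<theta>" "0 < \<gamma>\<phi>" "0 \<le> L\<theta>" "0 \<le> L\<phi>" "0 \<le> \<epsilon>\<theta>" "0 \<le> \<epsilon>\<phi>"
    and "loss_gradient \<Theta> (X \<times> Y) loss\<theta> grad\<theta>"
    and "loss_gradient \<Phi> (X \<times> Y) loss\<phi> grad\<phi>"
    and "strongly_convex_loss \<gamma>\<theta> \<Theta> (X \<times> Y) loss\<theta> grad\<theta>"
    and "strongly_convex_loss \<gamma>\<phi> \<Phi> (X \<times> Y) loss\<phi> grad\<phi>"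
    and "smooth_loss L\<theta> \<Theta> (X \<times> Y) grad\<theta>"
    and "smooth_loss L\<phi> \<Phi> (X \<times> Y) grad\<phi>"
    and "sensitive \<epsilon>\<theta> \<Theta> \<Phi> P"
    and "sensitive \<epsilon>\<phi> \<Theta> \<Phi> Q"
    and "\<kappa> = max ((\<gamma>\<theta> * L\<phi> * \<epsilon>\<phi> + 2 * \<gamma>\<phi> * L\<theta> * \<epsilon>\<theta>) / (\<gamma>\<phi> * (\<gamma>\<theta> - L\<theta> * \<epsilon>\<theta>)))
            (max ((\<gamma>\<phi> * L\<theta> * \<epsilon>\<theta> + 2 * \<gamma>\<theta> * L\<phi> * \<epsilon>\<phi>) / (\<gamma>\<theta> * (\<gamma>\<phi> - L\<phi> * \<epsilon>\<phi>)))
                 (L\<theta> * \<epsilon>\<theta> / \<gamma>\<theta> + L\<phi> * \<epsilon>\<phi> / \<gamma>\<phi>))"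
    and "\<kappa> < 1"
  shows "\<exists>\<theta>s \<phi>s. stable_point \<Theta> \<Phi> loss\<theta> loss\<phi> P Q \<theta>s \<phi>s \<and>
    (\<forall>upd \<theta> \<phi>. training_loop \<Theta> \<Phi> loss\<theta> loss\<phi> P Q upd \<theta> \<phi> \<longrightarrow>
       (\<lambda>t. (\<theta> t, \<phi> t)) \<longlonglongrightarrow> (\<theta>s, \<phi>s) \<and>
       (\<forall>t. norm ((\<theta> t, \<phi> t) - (\<theta>s, \<phi>s)) \<le> \<kappa> ^ t * norm ((\<theta> 0, \<phi> 0) - (\<theta>s, \<phi>s))))"
proof -
  interpret \<theta>: strongly_convex_learning \<Theta> "X \<times> Y" loss\<theta> grad\<theta> \<gamma>\<theta> L\<theta>
    using assms by unfold_locales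
  interpret \<phi>: strongly_convex_learning \<Phi> "X \<times> Y" loss\<phi> grad\<phi> \<gamma>\<phi> L\<phi>
    using assms by unfold_locales
  have P: "learning_distribution \<Theta> (X \<times> Y) loss\<theta> grad\<theta> \<gamma>\<theta> L\<theta> (P a b)"
    and Q: "learning_distribution \<Phi> (X \<times> Y) loss\<phi> grad\<phi> \<gamma>\<phi> L\<phi> (Q a b)"
    if "a \<in> \<Theta>" "b \<in> \<Phi>" for a b
    using assms(7-10)[OF that] by unfold_locales auto
  define \<rho> where "\<rho> = L\<theta> * \<epsilon>\<theta> / \<gamma>\<theta>"
  define \<sigma> where "\<sigma> = L\<phi> * \<epsilon>\<phi> / \<gamma>\<phi>"
  define F where "F a b = retrain \<Theta> loss\<theta> (P a b)" for a b
  define G where "G a b = retrain \<Phi> loss\<phi> (Q a b)" for a b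
  note in_F = learning_distribution.retrain_in[OF P, folded F_def]
  note in_G = learning_distribution.retrain_in[OF Q, folded G_def]
  have lip_F: "dist (F a b) (F a' b') \<le> \<rho> * dist (a, b) (a', b')"
    and lip_G: "dist (G a b) (G a' b') \<le> \<sigma> * dist (a, b) (a', b')"
    if "a \<in> \<Theta>" "b \<in> \<Phi>" "a' \<in> \<Theta>" "b' \<in> \<Phi>" for a b a' b'
  proof -
    have "wasserstein1 (P a b) (P a' b') \<le> ennreal (\<epsilon>\<theta> * dist (a, b) (a', b'))"
      "wasserstein1 (Q a b) (Q a' b') \<le> ennreal (\<epsilon>\<phi> * dist (a, b) (a', b'))"
      using \<open>sensitive \<epsilon>\<theta> \<Theta> \<Phi> P\<close> \<open>sensitive \<epsilon>\<phi> \<Theta> \<Phi> Q\<close> that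
      unfolding sensitive_def dist_norm by blast+
    with that assms(15,16) show "dist (F a b) (F a' b') \<le> \<rho> * dist (a, b) (a', b')"
      "dist (G a b) (G a' b') \<le> \<sigma> * dist (a, b) (a', b')"
      using \<theta>.retrain_stability[OF P P, of a b a' b'] \<phi>.retrain_stability[OF Q Q, of a b a' b']
      by (simp_all add: F_def G_def \<rho>_def \<sigma>_def mult.assoc)
  qed
  have \<rho>0: "0 \<le> \<rho>" and \<sigma>0: "0 \<le> \<sigma>" using assms by (simp_all add: \<rho>_def \<sigma>_def)
  have \<kappa>: "\<kappa> = max ((\<sigma> + 2 * \<rho>) / (1 - \<rho>)) (max ((\<rho> + 2 * \<sigma>) / (1 - \<sigma>)) (\<rho> + \<sigma>))"
  proof -
    have "\<gamma>\<theta> * L\<phi> * \<epsilon>\<phi> + 2 * \<gamma>\<phi> * L\<theta> * \<epsilon>\<theta> = (\<gamma>\<phi> * \<gamma>\<theta>) * (\<sigma> + 2 * \<rho>)"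
      "\<gamma>\<phi> * (\<gamma>\<theta> - L\<theta> * \<epsilon>\<theta>) = (\<gamma>\<phi> * \<gamma>\<theta>) * (1 - \<rho>)"
      "\<gamma>\<phi> * L\<theta> * \<epsilon>\<theta> + 2 * \<gamma>\<theta> * L\<phi> * \<epsilon>\<phi> = (\<gamma>\<phi> * \<gamma>\<theta>) * (\<rho> + 2 * \<sigma>)"
      "\<gamma>\<theta> * (\<gamma>\<phi> - L\<phi> * \<epsilon>\<phi>) = (\<gamma>\<phi> * \<gamma>\<theta>) * (1 - \<sigma>)"
      using assms(11,12) by (simp_all add: \<rho>_def \<sigma>_def field_simps)
    \<comment> \<open>Since \<open>p / 0 = 0\<close>, the cancellation also holds for
      \<open>q = 0\<close>, so it can precede the proof that \<open>1 - \<rho>\<close> and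
      \<open>1 - \<sigma>\<close> are positive.\<close>
    moreover have "(\<gamma>\<phi> * \<gamma>\<theta>) * p / ((\<gamma>\<phi> * \<gamma>\<theta>) * q) = p / q" for p q
      using assms(11,12) by simp
    ultimately show ?thesis
      using \<open>\<kappa> = _\<close> by (simp only: \<rho>_def[symmetric] \<sigma>_def[symmetric])
  qed
  have sum_le: "\<rho> + \<sigma> \<le> \<kappa>" by (simp add: \<kappa>)
  \<comment> \<open>The third entry of the maximum forces both denominators to be positive, so the
    first entry can serve as an upper bound for the asynchronous factor.\<close>
  then have "\<rho> < 1" "\<sigma> < 1" using \<open>\<kappa> < 1\<close> \<rho>0 \<sigma>0 by linarith+
  then have async_le: "\<rho> + \<sigma> + \<rho> * \<sigma> \<le> \<kappa>"
    using asynchronous_rate_le[of \<rho> \<sigma>] \<rho>0 \<sigma>0 by (simp add: \<kappa> le_max_iff_disj)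
  have \<kappa>0: "0 \<le> \<kappa>" using sum_le \<rho>0 \<sigma>0 by linarith
  have "\<exists>!p\<in>\<Theta> \<times> \<Phi>. (\<lambda>(a, b). (F a b, G a b)) p = p"
  proof (rule Banach_fix[OF iffD2[OF complete_eq_closed closed_Times[OF \<open>closed \<Theta>\<close> \<open>closed \<Phi>\<close>]],
        where c = "\<rho> + \<sigma>"])
    show "(\<lambda>(a, b). (F a b, G a b)) ` (\<Theta> \<times> \<Phi>) \<subseteq> \<Theta> \<times> \<Phi>" using in_F in_G by auto
    fix p q assume "p \<in> \<Theta> \<times> \<Phi>" "q \<in> \<Theta> \<times> \<Phi>"
    then show "dist ((\<lambda>(a, b). (F a b, G a b)) p) ((\<lambda>(a, b). (F a b, G a b)) q) \<le> (\<rho> + \<sigma>) * dist p q"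
      by (auto simp: distrib_right intro!: order_trans[OF dist_Pair_le] add_mono lip_F lip_G)
  qed (use assms \<rho>0 \<sigma>0 sum_le in auto)
  then obtain \<theta>s \<phi>s where s: "\<theta>s \<in> \<Theta>" "\<phi>s \<in> \<Phi>" "F \<theta>s \<phi>s = \<theta>s" "G \<theta>s \<phi>s = \<phi>s" by auto
  have stable: "stable_point \<Theta> \<Phi> loss\<theta> loss\<phi> P Q \<theta>s \<phi>s"
    using learning_distribution.retrain_is_arg_min[OF P[OF s(1,2)]]
      learning_distribution.retrain_is_arg_min[OF Q[OF s(1,2)]] s(3,4)
    unfolding stable_point_def F_def G_def by simp
  \<comment> \<open>Stated for arbitrary pairs in \<open>\<Theta> \<times> \<Phi>\<close>, so as to
    cover the mixed pairs of old and new parameters in asynchronous rounds.\<close>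
  have lip_Fs: "dist (F a b) \<theta>s \<le> \<rho> * dist (a, b) (\<theta>s, \<phi>s)"
    and lip_Gs: "dist (G a b) \<phi>s \<le> \<sigma> * dist (a, b) (\<theta>s, \<phi>s)" if "a \<in> \<Theta>" "b \<in> \<Phi>" for a b
    using lip_F[OF that s(1,2)] lip_G[OF that s(1,2)] s(3,4) by simp_all
  have "(\<lambda>t. (\<theta> t, \<phi> t)) \<longlonglongrightarrow> (\<theta>s, \<phi>s) \<and>
      (\<forall>t. norm ((\<theta> t, \<phi> t) - (\<theta>s, \<phi>s)) \<le> \<kappa> ^ t * norm ((\<theta> 0, \<phi> 0) - (\<theta>s, \<phi>s)))"
    if loop: "training_loop \<Theta> \<Phi> loss\<theta> loss\<phi> P Q upd \<theta> \<phi>" for upd \<theta> \<phi>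
  proof -
    let ?d = "\<lambda>t. dist (\<theta> t, \<phi> t) (\<theta>s, \<phi>s)"
    have init: "\<theta> 0 \<in> \<Theta>" "\<phi> 0 \<in> \<Phi>"
      and step: "\<And>t. case upd t of
          Synchronous \<Rightarrow> \<theta> (Suc t) = F (\<theta> t) (\<phi> t) \<and> \<phi> (Suc t) = G (\<theta> t) (\<phi> t)
        | Theta_First \<Rightarrow> \<theta> (Suc t) = F (\<theta> t) (\<phi> t) \<and> \<phi> (Suc t) = G (\<theta> (Suc t)) (\<phi> t)
        | Phi_First \<Rightarrow> \<phi> (Suc t) = G (\<theta> t) (\<phi> t) \<and> \<theta> (Suc t) = F (\<theta> t) (\<phi> (Suc t))"
      using loop unfolding training_loop_def F_def G_def by auto
    have inside: "\<theta> t \<in> \<Theta> \<and> \<phi> t \<in> \<Phi>" for t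
    proof (induction t)
      case (Suc t)
      then show ?case using step[of t] in_F in_G by (cases "upd t") auto
    qed (use init in simp)
    have contract: "?d (Suc t) \<le> \<kappa> * ?d t" for t
    proof -
      have t: "\<theta> t \<in> \<Theta>" "\<phi> t \<in> \<Phi>" and t': "\<theta> (Suc t) \<in> \<Theta>" "\<phi> (Suc t) \<in> \<Phi>"
        using inside by auto
      \<comment> \<open>The asynchronous factor serves all three orders: the synchronous factor
        \<open>\<rho> + \<sigma>\<close> is no larger.\<close>
      have "dist (\<theta> (Suc t)) \<theta>s + dist (\<phi> (Suc t)) \<phi>s \<le> (\<rho> + \<sigma> + \<rho> * \<sigma>) * ?d t"
      proof (cases "upd t")
        case Synchronous
        then have "dist (\<theta> (Suc t)) \<theta>s + dist (\<phi> (Suc t)) \<phi>s \<le> (\<rho> + \<sigma>) * ?d t"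
          using step[of t] lip_Fs[OF t] lip_Gs[OF t] by (simp add: distrib_right)
        also have "\<dots> \<le> (\<rho> + \<sigma> + \<rho> * \<sigma>) * ?d t"
          using \<rho>0 \<sigma>0 by (intro mult_right_mono) auto
        finally show ?thesis .
      next
        case Theta_First
        then show ?thesis
          using step[of t] lip_Fs[OF t] lip_Gs[OF t'(1) t(2)] \<rho>0 \<sigma>0
          by (intro asynchronous_contraction) auto
      next
        case Phi_First
        \<comment> \<open>The product distance is symmetric in its components, so this case is the
          previous one with the two models exchanged.\<close>
        have swap: "dist (b, a) (d, c) = dist (a, b) (c, d)" for a c :: 'a and b d :: 'b
          by (simp add: dist_Pair_Pair add.commute)
        have "dist (\<phi> (Suc t)) \<phi>s + dist (\<theta> (Suc t)) \<theta>s
            \<le> (\<sigma> + \<rho> + \<sigma> * \<rho>) * dist (\<phi> t, \<theta> t) (\<phi>s, \<theta>s)"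
          using Phi_First step[of t] lip_Gs[OF t] lip_Fs[OF t(1) t'(2)] \<rho>0 \<sigma>0
          by (intro asynchronous_contraction) (auto simp: swap)
        then show ?thesis by (simp add: swap ac_simps)
      qed
      also have "\<dots> \<le> \<kappa> * ?d t" using async_le by (rule mult_right_mono) simp
      finally show ?thesis using dist_Pair_le order_trans by blast
    qed
    have rate: "?d t \<le> \<kappa> ^ t * ?d 0" for t
    proof (induction t)
      case (Suc t)
      have "?d (Suc t) \<le> \<kappa> * (\<kappa> ^ t * ?d 0)"
        using contract[of t] mult_left_mono[OF Suc \<kappa>0] by linarith
      then show ?case by (simp add: mult.assoc)
    qed simp
    show ?thesis
      using linear_rate_tendsto[OF \<kappa>0 \<open>\<kappa> < 1\<close> rate] rate by (simp add: dist_norm)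
  qed
  with stable show ?thesis by blast
qed

end
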